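(* Let $n\ge 1$, let $z_1,\ldots,z_n\in\mathbb{C}$ and $\omega_1,\ldots,\omega_n\in\overline{\mathbb{C}}=\mathbb{C}\cup\{\infty\}$, and consider the problem of finding the rational functions $P^{(1)}/P^{(2)}$ ($P^{(1)},P^{(2)}$ complex polynomials) with $$\frac{P^{(1)}(z_j)}{P^{(2)}(z_j)}=\omega_j,\qquad j=1,\ldots,n, \qquad ( * )$$ where $\omega_j=\infty$ means that the rational function has a pole at $z_j$. Let $(I_n)$ be the associated linear interpolation problem (see context), and let $r=\begin{pmatrix} R^{(1)} \\ R^{(2)} \end{pmatrix}$ and $q=\begin{pmatrix} Q^{(1)} \\ Q^{(2)} \end{pmatrix}$ be a minimal generator and a second generator of $(I_n)$. Then each solution of $( * )$ has the form $$\frac{S(z)R^{(1)}(z)+T(z)Q^{(1)}(z)}{S(z)R^{(2)}(z)+T(z)Q^{(2)}(z)} \qquad ( ** )$$ with some complex polynomials $S$ and $T$. Conversely, if $S$ and $T$ are complex polynomials such that the denominator in $( ** )$ is not identically zero and the numerator and the denominator in $( ** )$ have no common roots, then $( ** )$ is a solution of $( * )$.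
   Context: Let $\mathbb{P}_\infty$ be the complex vector space of all vector-polynomials $p=\begin{pmatrix} P^{(1)} \\ P^{(2)} \end{pmatrix}$, where $P^{(1)},P^{(2)}$ are polynomials in $z$ with complex coefficients; it is a module over the ring of complex polynomials via $Sp=\begin{pmatrix} S P^{(1)} \\ S P^{(2)} \end{pmatrix}$. The height of $p\neq 0$ is $h(p)=2\deg P^{(1)}$ if $\deg P^{(1)}>\deg P^{(2)}$, and $h(p)=2\deg P^{(2)}+1$ if $\deg P^{(1)}\le\deg P^{(2)}$ (with $\deg 0=-\infty$); equivalently $h(p)=\max\{2\deg P^{(1)},\,2\deg P^{(2)}+1\}$. Put $h(0)=-\infty$. The associated problem $(I_n)$: put $\alpha_{j,1}=1$, $\alpha_{j,2}=-\omega_j$ if $\omega_j\ne\infty$, and $\alpha_{j,1}=0$, $\alpha_{j,2}=1$ if $\omega_j=\infty$. Problem $(I_n)$ is to find all $p\in\mathbb{P}_\infty$ with $\alpha_{j,1}P^{(1)}(z_j)+\alpha_{j,2}P^{(2)}(z_j)=0$ for $j=1,\ldots,n$; $\mathbb{P}_\infty(I_n)$ denotes the set of all its solutions, and $h(I_n)=\min\{h(p):p\in\mathbb{P}_\infty(I_n),\,p\ne0\}$. A minimal generator of $(I_n)$ is an element $r\in\mathbb{P}_\infty(I_n)$ with $h(r)=h(I_n)$. With $\mathbb{P}'_\infty(I_n)=\mathbb{P}_\infty(I_n)\setminus\{Sr:\ S\text{ a complex polynomial}\}$, a second generator of $(I_n)$ is an element $q\in\mathbb{P}'_\infty(I_n)$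 with $h(q)=\min\{h(p):p\in\mathbb{P}'_\infty(I_n)\}$. *)

theory Defs
  imports
    "HOL-Computational_Algebra.Computational_Algebra"
    "HOL-Computational_Algebra.Field_as_Ring"
    "HOL-Library.Extended_Real"
begin

type_synonym vpoly = "complex poly \<times> complex poly"

text \<open>The extended plane: \<^term>\<open>None\<close> is the point at infinity.\<close>

type_synonym ext_complex = "complex option"

text \<open>
  Value of a rational function in the extended plane, read off from its representation in lowest
  terms. So removable singularities are cancelled, and the value is infinity exactly at the poles.
\<close>

definition rat_value :: "complex poly fract \<Rightarrow> complex \<Rightarrow> ext_complex" where
  "rat_value F z =
     (let (A, B) = quot_of_fract F
      in if poly B z = 0 then None else Some (poly A z / poly B z))"

definition rational_solution ::
    "nat \<Rightarrow> (nat \<Rightarrow> complex) \<Rightarrow> (nat \<Rightarrow> ext_complex) \<Rightarrow> complex poly fract \<Rightarrow> bool" where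
  "rational_solution n z \<omega> F \<longleftrightarrow> (\<forall>j\<in>{1..n}. rat_value F (z j) = \<omega> j)"

definition vsmult :: "complex poly \<Rightarrow> vpoly \<Rightarrow> vpoly" where
  "vsmult S p = (S * fst p, S * snd p)"

text \<open>The library's \<^const>\<open>degree\<close> of the zero polynomial is 0; here it has to be minus infinity.\<close>

definition edegree :: "complex poly \<Rightarrow> ereal" where
  "edegree P = (if P = 0 then - \<infinity> else ereal (real (degree P)))"

text \<open>For \<open>p = 0\<close> the second branch yields minus infinity.\<close>

definition height :: "vpoly \<Rightarrow> ereal" where
  "height p = (if edegree (fst p) > edegree (snd p) then 2 * edegree (fst p)
               else 2 * edegree (snd p) + 1)"

definition alpha1 :: "ext_complex \<Rightarrow> complex" where
  "alpha1 w = (case w of Some c \<Rightarrow> 1 | None \<Rightarrow> 0)"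

definition alpha2 :: "ext_complex \<Rightarrow> complex" where
  "alpha2 w = (case w of Some c \<Rightarrow> - c | None \<Rightarrow> 1)"

definition lin_solutions :: "nat \<Rightarrow> (nat \<Rightarrow> complex) \<Rightarrow> (nat \<Rightarrow> ext_complex) \<Rightarrow> vpoly set" where
  "lin_solutions n z \<omega> =
     {p. \<forall>j\<in>{1..n}. alpha1 (\<omega> j) * poly (fst p) (z j) + alpha2 (\<omega> j) * poly (snd p) (z j) = 0}"

text \<open>
  Nonzero vector polynomials have heights in the natural numbers, so the infima below are minima.
\<close>

definition problem_height :: "nat \<Rightarrow> (nat \<Rightarrow> complex) \<Rightarrow> (nat \<Rightarrow> ext_complex) \<Rightarrow> ereal" where
  "problem_height n z \<omega> = (INF p \<in> lin_solutions n z \<omega> - {(0, 0)}. height p)"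

definition minimal_generator ::
    "nat \<Rightarrow> (nat \<Rightarrow> complex) \<Rightarrow> (nat \<Rightarrow> ext_complex) \<Rightarrow> vpoly \<Rightarrow> bool" where
  "minimal_generator n z \<omega> r \<longleftrightarrow>
     r \<in> lin_solutions n z \<omega> \<and> height r = problem_height n z \<omega>"

definition reduced_solutions ::
    "nat \<Rightarrow> (nat \<Rightarrow> complex) \<Rightarrow> (nat \<Rightarrow> ext_complex) \<Rightarrow> vpoly \<Rightarrow> vpoly set" where
  "reduced_solutions n z \<omega> r = lin_solutions n z \<omega> - {vsmult S r | S. True}"

definition second_generator ::
    "nat \<Rightarrow> (nat \<Rightarrow> complex) \<Rightarrow> (nat \<Rightarrow> ext_complex) \<Rightarrow> vpoly \<Rightarrow> vpoly \<Rightarrow> bool" where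
  "second_generator n z \<omega> r q \<longleftrightarrow>
     q \<in> reduced_solutions n z \<omega> r \<and>
     height q = (INF p \<in> reduced_solutions n z \<omega> r. height p)"

end

theory Submission
  imports Defs "HOL-Library.Product_Plus"
begin

text \<open>
  The solutions of the linear problem form a module over the complex polynomials, and the theorem
  rests on the fact that a minimal generator \<open>r\<close> and a second generator \<open>q\<close> span this module
  (\<open>generators_generate\<close>). The reason is a division algorithm in which the height plays the role
  of the degree. Multiplying by a monomial of degree \<open>k\<close> raises the height by \<open>2 * k\<close>, so
  if two vector polynomials have heights of the same parity, then a monomial multiple of the lower
  one can be subtracted from the higher one so that the height drops
  (\<open>cancel_leading_term\<close>). If \<open>r\<close> and \<open>q\<close> had heights of the same parity, this step
  would produce a solution lower than \<open>q\<close> that is still not a multiple of \<open>r\<close>, against the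
  choice of \<open>q\<close>. So the two parities differ, every solution shares its parity with one of
  the two generators, and repeated reduction brings it down to a multiple of \<open>r\<close>
  (\<open>minimal_elements_generate\<close>).

  The rational and the linear problem are matched by \<open>rational_solution_iff_lin_solutions\<close>: as
  long as numerator and denominator have no common root, both conditions at a node say that the
  point of the projective line given by the two values is the prescribed one. Every rational
  function has such a representation, namely the one in lowest terms, which gives the first half;
  in the second half the absence of common roots is a hypothesis.
\<close>

section \<open>The height as a degree\<close>

text \<open>
  The polynomial \<open>P1 (z\<^sup>2) + z * P2 (z\<^sup>2)\<close>, whose even and odd parts carry the two components. Its
  degree is the height of \<open>(P1, P2)\<close>, which turns statements about heights into statements about
  degrees of ordinary polynomials.
\<close>

definition interleave :: "vpoly \<Rightarrow> complex poly" where
  "interleave p = pcompose (fst p) [:0, 0, 1:] + pCons 0 (pcompose (snd p) [:0, 0, 1:])"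

lemma degree_pcompose_square: "degree (pcompose P [:0, 0, 1 :: complex:]) = 2 * degree P"
  by (simp add: degree_pcompose)

lemma pcompose_square_eq_0_iff: "pcompose P [:0, 0, 1 :: complex:] = 0 \<longleftrightarrow> P = 0"
  using pcompose_eq_0[of P "[:0, 0, 1:]"] by auto

text \<open>
  The two summands of the interleaved polynomial have degrees of different parity, so their leading
  terms cannot cancel, and the larger degree wins.
\<close>

lemma height_eq_edegree_interleave: "height p = edegree (interleave p)"
proof -
  define A where "A = pcompose (fst p) [:0, 0, 1:]"
  define B where "B = pcompose (snd p) [:0, 0, 1:]"
  have dA: "degree A = 2 * degree (fst p)" and dB: "degree B = 2 * degree (snd p)"
    by (simp_all add: A_def B_def degree_pcompose_square)
  have zA: "A = 0 \<longleftrightarrow> fst p = 0" and zB: "B = 0 \<longleftrightarrow> snd p = 0"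
    by (simp_all add: A_def B_def pcompose_square_eq_0_iff)
  have i: "interleave p = A + pCons 0 B"
    by (simp add: interleave_def A_def B_def)
  show ?thesis
  proof (cases "fst p = 0 \<or> snd p = 0")
    case True
    then show ?thesis
      using dA dB zA zB by (auto simp: i height_def edegree_def)
  next
    case False
    then have nz: "A \<noteq> 0" "B \<noteq> 0" "fst p \<noteq> 0" "snd p \<noteq> 0"
      using zA zB by auto
    have dB': "degree (pCons 0 B) = Suc (2 * degree (snd p))"
      using nz dB by simp
    show ?thesis
    proof (cases "degree (fst p) > degree (snd p)")
      case True
      then have d: "degree (A + pCons 0 B) = 2 * degree (fst p)"
        using degree_add_eq_left[of "pCons 0 B" A] dA dB' by simp
      with True have "A + pCons 0 B \<noteq> 0" by auto
      with d True nz show ?thesis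
        by (simp add: i height_def edegree_def)
    next
      case F: False
      then have d: "degree (A + pCons 0 B) = Suc (2 * degree (snd p))"
        using degree_add_eq_right[of A "pCons 0 B"] dA dB' by simp
      then have "A + pCons 0 B \<noteq> 0" by auto
      with d F nz show ?thesis
        by (simp add: i height_def edegree_def)
    qed
  qed
qed

lemma interleave_eq_0_iff: "interleave p = 0 \<longleftrightarrow> p = 0"
proof
  assume "interleave p = 0"
  then have "height p = - \<infinity>"
    by (simp add: height_eq_edegree_interleave edegree_def)
  then show "p = 0"
    by (auto simp: height_def edegree_def prod_eq_iff split: if_splits)
qed (simp add: interleave_def)

text \<open>
  Interleaving is linear over the substitution of \<open>z\<^sup>2\<close> for \<open>z\<close>: a scalar polynomial acts as an
  even polynomial. This is why multiplication by a nonzero scalar polynomial preserves the parity of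
  the height of a nonzero vector.
\<close>

lemma interleave_diff_vsmult:
  "interleave (p - vsmult S r) = interleave p - pcompose S [:0, 0, 1:] * interleave r"
proof -
  \<comment> \<open>With opaque names for \<open>z\<^sup>2\<close> and \<open>z\<close> the claim is a plain ring identity.\<close>
  define sq where "sq = [:0, 0, 1 :: complex:]"
  define X where "X = [:0, 1 :: complex:]"
  have i: "interleave p = pcompose (fst p) sq + X * pcompose (snd p) sq" for p
    by (simp add: interleave_def sq_def X_def)
  show ?thesis
    unfolding sq_def[symmetric]
    by (simp add: i vsmult_def pcompose_diff pcompose_mult algebra_simps)
qed

section \<open>Division with respect to the height\<close>

text \<open>
  One step of polynomial long division, carried out on the interleaved polynomials. The quotient of
  the two leading terms has even degree exactly because the parities agree, and only then does it
  come from a scalar polynomial.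
\<close>

lemma cancel_leading_term:
  assumes "p \<noteq> 0" "r \<noteq> 0" "height r \<le> height p"
    and "even (degree (interleave p)) = even (degree (interleave r))"
  obtains S where "height (p - vsmult S r) < height p"
proof -
  let ?f = "interleave p" and ?g = "interleave r"
  have nz: "?f \<noteq> 0" "?g \<noteq> 0"
    using assms by (simp_all add: interleave_eq_0_iff)
  then have "degree ?g \<le> degree ?f"
    using assms by (simp add: height_eq_edegree_interleave edegree_def)
  moreover from this assms have "even (degree ?f - degree ?g)"
    by simp
  ultimately obtain k where k: "degree ?f = 2 * k + degree ?g"
    by (metis evenE le_add_diff_inverse2)
  define c where "c = lead_coeff ?f / lead_coeff ?g"
  have "pcompose (monom c k) [:0, 0, 1:] = monom c (2 * k)"
  proof -
    have sq: "[:0, 0, 1:] = monom (1 :: complex) 2"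
      by (simp add: numeral_2_eq_2 monom_Suc monom_0)
    show ?thesis
      unfolding sq by (induction k) (simp_all add: monom_0 monom_Suc pcompose_pCons mult_monom numeral_2_eq_2)
  qed
  then have h: "interleave (p - vsmult (monom c k) r) = ?f - monom c (2 * k) * ?g"
    by (simp add: interleave_diff_vsmult)
  have "degree (?f - monom c (2 * k) * ?g) \<le> degree ?f"
    by (rule degree_diff_le) (auto simp: k intro!: order.trans[OF degree_mult_le] degree_monom_le)
  moreover have "coeff (?f - monom c (2 * k) * ?g) (degree ?f) = 0"
    using nz by (simp add: coeff_monom_mult k c_def)
  ultimately have "?f - monom c (2 * k) * ?g = 0 \<or> degree (?f - monom c (2 * k) * ?g) < degree ?f"
    by (rule eq_zero_or_degree_less)
  then have "height (p - vsmult (monom c k) r) < height p"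
    using nz by (auto simp: height_eq_edegree_interleave h edegree_def)
  then show ?thesis ..
qed

text \<open>
  The division algorithm uses only that \<open>M\<close> is closed under subtracting polynomial multiples and
  that \<open>r\<close> and \<open>q\<close> are minimal, so it holds for any such set in place of the solution set.
\<close>

lemma minimal_elements_generate:
  assumes closed: "\<And>p p' S. p \<in> M \<Longrightarrow> p' \<in> M \<Longrightarrow> p - vsmult S p' \<in> M"
    and r: "r \<in> M" "r \<noteq> 0" "\<And>p. p \<in> M \<Longrightarrow> p \<noteq> 0 \<Longrightarrow> height r \<le> height p"
    and q: "q \<in> M" "\<And>S. q \<noteq> vsmult S r"
      "\<And>p. p \<in> M \<Longrightarrow> (\<And>S. p \<noteq> vsmult S r) \<Longrightarrow> height q \<le> height p"
    and "p \<in> M"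
  shows "\<exists>S T. p = vsmult S r + vsmult T q"
proof -
  have vsmult_add: "vsmult (S + S') r = vsmult S r + vsmult S' r" for S S' r
    by (simp add: vsmult_def algebra_simps)
  have q0: "q \<noteq> 0"
    using q(2)[of 0] by (auto simp: vsmult_def zero_prod_def)
  have opposite: "even (degree (interleave q)) \<noteq> even (degree (interleave r))"
  proof
    assume "even (degree (interleave q)) = even (degree (interleave r))"
    then obtain S where S: "height (q - vsmult S r) < height q"
      using cancel_leading_term[of q r] q0 q(1) r by metis
    have "q - vsmult S r \<noteq> vsmult T r" for T
      using q(2)[of "S + T"] by (simp add: vsmult_add algebra_simps)
    then have "height q \<le> height (q - vsmult S r)"
      using q(3) closed q(1) r(1) by blast
    with S show False by simp
  qed
  \<comment> \<open>The induction measure is the height, shifted by one so that zero lies below the vectors of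
    height zero.\<close>
  show ?thesis
    using \<open>p \<in> M\<close>
  proof (induction "if p = 0 then 0 else Suc (degree (interleave p))" arbitrary: p
      rule: less_induct)
    case less
    show ?case
    \<comment> \<open>Outside the multiples of \<open>r\<close> the height of \<open>p\<close> is at least that of \<open>q\<close> and
      that of \<open>r\<close>, so the generator of matching parity can always be used to reduce \<open>p\<close>.\<close>
    proof (cases "\<exists>S. p = vsmult S r")
      case True
      then obtain S where "p = vsmult S r" ..
      then have "p = vsmult S r + vsmult 0 q"
        by (simp add: vsmult_def)
      then show ?thesis by blast
    next
      case False
      then have p0: "p \<noteq> 0"
        by (metis vsmult_def mult_zero_left zero_prod_def)
      have descend: "\<exists>S T. p - vsmult U g = vsmult S r + vsmult T q"
        if "height (p - vsmult U g) < height p" "g \<in> M" for U g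
        using that p0 less.prems closed
        by (intro less.hyps)
          (auto simp: height_eq_edegree_interleave edegree_def interleave_eq_0_iff)
      show ?thesis
      proof (cases "even (degree (interleave p)) = even (degree (interleave r))")
        case True
        then obtain U where "height (p - vsmult U r) < height p"
          using cancel_leading_term[of p r] p0 less.prems r by metis
        then obtain S T where "p - vsmult U r = vsmult S r + vsmult T q"
          using descend r(1) by blast
        then have "p = vsmult (U + S) r + vsmult T q"
          by (simp add: vsmult_add algebra_simps)
        then show ?thesis by blast
      next
        case par: False
        then have "even (degree (interleave p)) = even (degree (interleave q))"
          using opposite by blast
        then obtain U where "height (p - vsmult U q) < height p"
          using cancel_leading_term[of p q] p0 q0 less.prems q(3) False by metis
        then obtain S T where "p - vsmult U q = vsmult S r + vsmult T q"
          using descend q(1) by blast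
        then have "p = vsmult S r + vsmult (U + T) q"
          by (simp add: vsmult_add algebra_simps)
        then show ?thesis by blast
      qed
    qed
  qed
qed

section \<open>Solutions of the linear problem\<close>

lemma height_nonneg: "p \<noteq> 0 \<Longrightarrow> 0 \<le> height p"
  by (simp add: height_eq_edegree_interleave edegree_def interleave_eq_0_iff)

lemma lin_solutions_diff_vsmult:
  assumes "p \<in> lin_solutions n z \<omega>" "p' \<in> lin_solutions n z \<omega>"
  shows "p - vsmult S p' \<in> lin_solutions n z \<omega>"
  unfolding lin_solutions_def
proof (intro CollectI ballI)
  fix j assume j: "j \<in> {1..n}"
  let ?L = "\<lambda>p. alpha1 (\<omega> j) * poly (fst p) (z j) + alpha2 (\<omega> j) * poly (snd p) (z j)"
  have "?L (p - vsmult S p') = ?L p - poly S (z j) * ?L p'"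
    by (simp add: vsmult_def algebra_simps)
  also have "\<dots> = 0"
    using assms j by (simp add: lin_solutions_def)
  finally show "?L (p - vsmult S p') = 0" .
qed

text \<open>
  A minimal generator is nonzero, since nonzero solutions have nonnegative heights, whereas zero has
  height minus infinity; the division algorithm therefore applies.
\<close>

lemma generators_generate:
  assumes "minimal_generator n z \<omega> r" "second_generator n z \<omega> r q"
  shows "p \<in> lin_solutions n z \<omega> \<longleftrightarrow> (\<exists>S T. p = vsmult S r + vsmult T q)"
proof
  have r: "r \<in> lin_solutions n z \<omega>"
    and hr: "height r = (INF p \<in> lin_solutions n z \<omega> - {0}. height p)"
    using assms(1) by (auto simp: minimal_generator_def problem_height_def zero_prod_def)
  have q: "q \<in> lin_solutions n z \<omega>" "q \<noteq> vsmult S r"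
    and hq: "height q = (INF p \<in> reduced_solutions n z \<omega> r. height p)" for S
    using assms(2) by (auto simp: second_generator_def reduced_solutions_def)
  {
    have "0 \<le> height r"
      unfolding hr by (intro INF_greatest height_nonneg) auto
    then have r0: "r \<noteq> 0"
      by (auto simp: height_def edegree_def)
    assume "p \<in> lin_solutions n z \<omega>"
    then show "\<exists>S T. p = vsmult S r + vsmult T q"
    proof (rule minimal_elements_generate[rotated -1])
      show "height r \<le> height p" if "p \<in> lin_solutions n z \<omega>" "p \<noteq> 0" for p
        unfolding hr using that by (intro INF_lower) auto
      show "height q \<le> height p" if "p \<in> lin_solutions n z \<omega>" "\<And>S. p \<noteq> vsmult S r" for p
        unfolding hq using that by (intro INF_lower) (auto simp: reduced_solutions_def)
    qed (use r r0 q lin_solutions_diff_vsmult in auto)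
  }
  assume "\<exists>S T. p = vsmult S r + vsmult T q"
  then obtain S T where "p = vsmult S r + vsmult T q" by blast
  \<comment> \<open>The combination is written with subtractions of multiples only, the form in which the
    closure of the solution set is available.\<close>
  then have "p = (r - vsmult (1 - S) r) - vsmult (- T) q"
    by (simp add: vsmult_def prod_eq_iff algebra_simps)
  then show "p \<in> lin_solutions n z \<omega>"
    using r q(1) by (simp add: lin_solutions_diff_vsmult)
qed

section \<open>Values of rational functions\<close>

lemma coprime_no_common_root:
  assumes "coprime A (B :: complex poly)"
  shows "\<not> (poly A x = 0 \<and> poly B x = 0)"
proof
  assume "poly A x = 0 \<and> poly B x = 0"
  then have "is_unit [:- x, 1:]"
    using assms by (metis coprime_common_divisor poly_eq_0_iff_dvd)
  then show False
    by (simp add: is_unit_pCons_iff)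
qed

text \<open>
  The value is defined through lowest terms, but any representation whose numerator and denominator
  do not both vanish at \<open>x\<close> gives the same value: cross-multiplication shows that the two pairs of
  values at \<open>x\<close> are proportional, and neither pair is zero.
\<close>

lemma rat_value_Fract:
  assumes "B \<noteq> 0" "\<not> (poly A x = 0 \<and> poly B x = 0)"
  shows "rat_value (Fract A B) x = (if poly B x = 0 then None else Some (poly A x / poly B x))"
proof -
  obtain A' B' where AB': "quot_of_fract (Fract A B) = (A', B')"
    by fastforce
  then have B': "B' \<noteq> 0" and cop: "coprime A' B'"
    using snd_quot_of_fract_nonzero[of "Fract A B"] coprime_quot_of_fract[of "Fract A B"] by simp_all
  have "Fract A' B' = Fract A B"
    using Fract_quot_of_fract[of "Fract A B"] AB' by simp
  then have "A' * B = A * B'"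
    using B' assms(1) by (simp add: eq_fract)
  then have "poly A' x * poly B x = poly A x * poly B' x"
    by (metis poly_mult)
  then show ?thesis
    using coprime_no_common_root[OF cop, of x] assms(2) AB'
    by (auto simp: rat_value_def frac_eq_eq)
qed

text \<open>
  Each linear equation is the cross-multiplied form of the corresponding interpolation condition.
  Cross-multiplication is reversible wherever the two values do not both vanish.
\<close>

lemma rational_solution_iff_lin_solutions:
  assumes "B \<noteq> 0" "\<And>x. \<not> (poly A x = 0 \<and> poly B x = 0)"
  shows "rational_solution n z \<omega> (Fract A B) \<longleftrightarrow> (A, B) \<in> lin_solutions n z \<omega>"
proof -
  have "rat_value (Fract A B) x = w \<longleftrightarrow> alpha1 w * poly A x + alpha2 w * poly B x = 0" for x w
    using assms(2)[of x] rat_value_Fract[OF assms(1), of A x]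
    by (cases w) (auto simp: alpha1_def alpha2_def divide_simps)
  then show ?thesis
    by (simp add: rational_solution_def lin_solutions_def)
qed

section \<open>Parametrization of the rational solutions\<close>

theorem theorem2p12:
  fixes n :: nat
    and z :: "nat \<Rightarrow> complex"
    and \<omega> :: "nat \<Rightarrow> ext_complex"
    and R1 R2 Q1 Q2 :: "complex poly"
  assumes "n \<ge> 1"
    and "minimal_generator n z \<omega> (R1, R2)"
    and "second_generator n z \<omega> (R1, R2) (Q1, Q2)"
  shows "(\<forall>F. rational_solution n z \<omega> F \<longrightarrow>
            (\<exists>S T. S * R2 + T * Q2 \<noteq> 0 \<and> F = Fract (S * R1 + T * Q1) (S * R2 + T * Q2))) \<and>
         (\<forall>S T. S * R2 + T * Q2 \<noteq> 0 \<longrightarrow>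
            \<not> (\<exists>x. poly (S * R1 + T * Q1) x = 0 \<and> poly (S * R2 + T * Q2) x = 0) \<longrightarrow>
            rational_solution n z \<omega> (Fract (S * R1 + T * Q1) (S * R2 + T * Q2)))"
proof (intro conjI allI impI)
  have gen: "(A, B) \<in> lin_solutions n z \<omega> \<longleftrightarrow>
      (\<exists>S T. A = S * R1 + T * Q1 \<and> B = S * R2 + T * Q2)" for A B
    using generators_generate[OF assms(2,3)] by (simp add: vsmult_def)
  {
    fix F assume F: "rational_solution n z \<omega> F"
    obtain A B where AB: "quot_of_fract F = (A, B)"
      by fastforce
    have B: "B \<noteq> 0" and cop: "coprime A B" and FAB: "F = Fract A B"
      using snd_quot_of_fract_nonzero[of F] coprime_quot_of_fract[of F] Fract_quot_of_fract[of F] AB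
      by simp_all
    have "(A, B) \<in> lin_solutions n z \<omega>"
      using F rational_solution_iff_lin_solutions[OF B coprime_no_common_root[OF cop]] FAB by simp
    then show "\<exists>S T. S * R2 + T * Q2 \<noteq> 0 \<and> F = Fract (S * R1 + T * Q1) (S * R2 + T * Q2)"
      using gen[of A B] B FAB by metis
  }
  fix S T
  assume "S * R2 + T * Q2 \<noteq> 0"
    and "\<not> (\<exists>x. poly (S * R1 + T * Q1) x = 0 \<and> poly (S * R2 + T * Q2) x = 0)"
  then show "rational_solution n z \<omega> (Fract (S * R1 + T * Q1) (S * R2 + T * Q2))"
    using gen by (subst rational_solution_iff_lin_solutions) blast+
qed

end
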